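(* Let $f_0$ be a probability density function on $\mathbb{R}$ with $f_0(x)=f_0(-x)$ for all $x$, let $G:\mathbb{R}\to\mathbb{R}$ satisfy $G(x)\ge 0$ and $G(x)+G(-x)=1$ for all $x\in\mathbb{R}$, and let $f(x)=2f_0(x)G(x)$. (1) If $G$ is increasing and $f_0$ is unimodal at $0$, then $f$ has no negative mode. If, moreover, $f_0$ and $G$ have continuous derivative everywhere on the support of $f_0$, $G(x)$ is concave for $x>0$, and $f_0$ is log-concave, where at least one of these two properties (concavity of $G$ for $x>0$, log-concavity of $f_0$) holds in the strict sense, then $f$ has a unique positive mode. (2) If $G$ is decreasing and $f_0$ is unimodal at $0$, then $f$ has no positive mode. If, moreover, $f_0$ and $G$ have continuous derivative everywhere on the support of $f_0$, $G(x)$ is concave for $x<0$, and $f_0$ is log-concave, where at least one of these two properties (concavity of $G$ for $x<0$, log-concavity of $f_0$) holds in the strict sense, then $f$ has a unique negative mode.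
   Context: "Increasing" and "decreasing" are meant strictly (as opposed to non-decreasing, non-increasing). $f_0$ is unimodal at $0$ if it is non-decreasing on $(-\infty,0]$ and non-increasing on $[0,\infty)$. A mode of $f$ is a point of the support of $f_0$ at which $f$, as a function on that support, attains a (local or global) maximum value, a pole being regarded as a maximum point; when the support is bounded a mode may be at an endpoint of it. Log-concavity (strict log-concavity) of $f_0$ means that $\log f_0$ is concave (strictly concave) on the support of $f_0$. *)

theory Defs
  imports "HOL-Analysis.Analysis"
begin

definition is_pdf :: "(real \<Rightarrow> real) \<Rightarrow> bool" where
  "is_pdf f0 \<longleftrightarrow> (\<forall>x. 0 \<le> f0 x) \<and> has_bochner_integral lborel f0 1"

(* The support is closed, so a bounded support contains its endpoints, whatever the
   value of the density there. *)
definition pdf_support :: "(real \<Rightarrow> real) \<Rightarrow> real set" where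
  "pdf_support f0 = closure {x. f0 x > 0}"

definition unimodal_at_0 :: "(real \<Rightarrow> real) \<Rightarrow> bool" where
  "unimodal_at_0 f0 \<longleftrightarrow> mono_on {..0} f0 \<and> antimono_on {0..} f0"

(* Local maximum or pole of f as a function on S: the filter "at x within S" makes both
   one-sided when x is an endpoint of S. Every global maximum is a local one.
   Without "x islimpt S" an isolated point of S would vacuously be a pole. *)
definition is_mode_on :: "real set \<Rightarrow> (real \<Rightarrow> real) \<Rightarrow> real \<Rightarrow> bool" where
  "is_mode_on S f x \<longleftrightarrow> x \<in> S \<and>
     ((\<forall>\<^sub>F y in at x within S. f y \<le> f x) \<or>
      (x islimpt S \<and> filterlim f at_top (at x within S)))"

(* The derivative is taken within S, hence one-sided at an endpoint of S. *)
definition continuously_differentiable_within :: "real set \<Rightarrow> (real \<Rightarrow> real) \<Rightarrow> bool" where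
  "continuously_differentiable_within S f \<longleftrightarrow>
     (\<exists>f'. continuous_on S f' \<and> (\<forall>x\<in>S. (f has_real_derivative f' x) (at x within S)))"

definition strictly_concave_on :: "real set \<Rightarrow> (real \<Rightarrow> real) \<Rightarrow> bool" where
  "strictly_concave_on S f \<longleftrightarrow> convex S \<and>
     (\<forall>x\<in>S. \<forall>y\<in>S. \<forall>u>0. \<forall>v>0. x \<noteq> y \<and> u + v = 1 \<longrightarrow>
        u * f x + v * f y < f (u * x + v * y))"

(* Concavity of the logarithm on the support, with log 0 = -\<infinity>. Since HOL's real
   ln is 0 at 0, the set is restricted to the points where f0 > 0. Nothing is lost: the
   positivity set is required to be convex (part of concave_on and strictly_concave_on),
   so the support adds at most endpoints with f0 = 0, and there the inequality for
   log f0 = -\<infinity> holds automatically. *)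
definition log_concave_pdf :: "(real \<Rightarrow> real) \<Rightarrow> bool" where
  "log_concave_pdf f0 \<longleftrightarrow> concave_on {x. f0 x > 0} (\<lambda>x. ln (f0 x))"

definition strictly_log_concave_pdf :: "(real \<Rightarrow> real) \<Rightarrow> bool" where
  "strictly_log_concave_pdf f0 \<longleftrightarrow> strictly_concave_on {x. f0 x > 0} (\<lambda>x. ln (f0 x))"

end

theory Submission
  imports Defs
begin

text \<open>
  Let \<open>G\<close> be increasing; the decreasing case is its mirror image, since \<open>x \<mapsto> f (- x)\<close> is the skewing
  of the same symmetric density by the increasing function \<open>x \<mapsto> G (- x)\<close>.

  As \<open>f0\<close> is finite at its peak and \<open>0 < G < 1\<close>, the function \<open>f\<close> is bounded, so modes are local
  maxima and poles never occur. To the left of \<open>0\<close>, moving right increases \<open>G\<close> strictly and does not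
  decrease \<open>f0\<close>, so no point there is a local maximum (\<open>no_negative_mode\<close>).

  A positive mode exists because \<open>f\<close> rises immediately to the right of \<open>0\<close> and falls below \<open>f 0\<close>
  in the long run. For the rise, \<open>f0\<close> is even, hence flat at \<open>0\<close>, so that the slope of \<open>f\<close>
  there is \<open>2 * f0 0\<close> times the slope of \<open>G\<close>; and the latter is positive because a concave function
  starts at least as steeply as any chord from its starting point, and those of \<open>G\<close> rise
  (\<open>increases_right_of_0\<close>). For the fall, a symmetric unimodal
  density of total mass \<open>1\<close> satisfies \<open>f0 x \<le> 1 / x\<close> (\<open>f0_tail\<close>). The maximum of \<open>f\<close> over
  a compact piece of the support is therefore attained at a positive point and is maximal over the
  whole positive part (\<open>positive_mode_exists\<close>).

  It is unique because \<open>ln f\<close> is, up to a constant, the sum of the concave functions \<open>ln f0\<close> and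
  \<open>ln G\<close>, one of which is strictly concave (\<open>strictly_log_concave_right_of_0\<close>), and along a segment
  towards a point that is at least as high a strictly log-concave function rises at once
  (\<open>strictly_log_concave_no_lower_local_max\<close>).
\<close>

section \<open>Strict concavity of logarithms\<close>

lemma strictly_concave_on_add_concave:
  assumes "strictly_concave_on T a" and "concave_on T b"
  shows "strictly_concave_on T (\<lambda>x. a x + b x)"
  unfolding strictly_concave_on_def
proof (intro conjI ballI allI impI)
  show "convex T" using assms(2) by (rule concave_on_imp_convex)
  fix x y u v :: real
  assume *: "x \<in> T" "y \<in> T" "0 < u" "0 < v" "x \<noteq> y \<and> u + v = 1"
  have "u * a x + v * a y < a (u * x + v * y)"
    using assms(1) * by (auto simp: strictly_concave_on_def)
  moreover have "u * b x + v * b y \<le> b (u * x + v * y)"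
    using assms(2) * by (auto simp: concave_on_iff)
  ultimately show "u * (a x + b x) + v * (a y + b y) < a (u * x + v * y) + b (u * x + v * y)"
    by (simp add: algebra_simps)
qed

lemma strictly_concave_on_subset:
  "strictly_concave_on S f \<Longrightarrow> T \<subseteq> S \<Longrightarrow> convex T \<Longrightarrow> strictly_concave_on T f"
  unfolding strictly_concave_on_def by (meson subsetD)

lemma concave_on_subset_convex:
  "concave_on S f \<Longrightarrow> T \<subseteq> S \<Longrightarrow> convex T \<Longrightarrow> concave_on T f"
  unfolding concave_on_def by (rule convex_on_subset)

lemma ln_convex_combination_le:
  fixes x y :: real
  assumes "0 < x" "0 < y" "0 \<le> u" "0 \<le> v" "u + v = 1"
  shows "u * ln x + v * ln y \<le> ln (u * x + v * y)"
  using ln_concave assms by (auto simp: concave_on_iff)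

lemma concave_on_ln_compose:
  fixes g :: "real \<Rightarrow> real"
  assumes "concave_on T g" and pos: "\<And>x. x \<in> T \<Longrightarrow> 0 < g x"
  shows "concave_on T (\<lambda>x. ln (g x))"
  unfolding concave_on_iff
proof (intro conjI ballI allI impI)
  show "convex T" using assms(1) by (rule concave_on_imp_convex)
  fix x y u v :: real
  assume *: "x \<in> T" "y \<in> T" "0 \<le> u" "0 \<le> v" "u + v = 1"
  have "u * g x + v * g y \<le> g (u * x + v * y)"
    using assms(1) * by (auto simp: concave_on_iff)
  moreover have "0 < u * g x + v * g y"
    using pos[OF *(1)] pos[OF *(2)] *(3-5)
    by (smt (verit) mult_pos_pos mult_nonneg_nonneg)
  ultimately have "ln (u * g x + v * g y) \<le> ln (g (u * x + v * y))"
    by simp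
  then show "u * ln (g x) + v * ln (g y) \<le> ln (g (u *\<^sub>R x + v *\<^sub>R y))"
    using ln_convex_combination_le[OF pos[OF *(1)] pos[OF *(2)] *(3-5)] by simp
qed

lemma strictly_concave_on_ln_compose:
  fixes g :: "real \<Rightarrow> real"
  assumes "strictly_concave_on T g" and pos: "\<And>x. x \<in> T \<Longrightarrow> 0 < g x"
  shows "strictly_concave_on T (\<lambda>x. ln (g x))"
  unfolding strictly_concave_on_def
proof (intro conjI ballI allI impI)
  show "convex T" using assms(1) by (simp add: strictly_concave_on_def)
  fix x y u v :: real
  assume *: "x \<in> T" "y \<in> T" "0 < u" "0 < v" "x \<noteq> y \<and> u + v = 1"
  have "u * g x + v * g y < g (u * x + v * y)"
    using assms(1) * by (auto simp: strictly_concave_on_def)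
  moreover have "0 < u * g x + v * g y"
    using pos[OF *(1)] pos[OF *(2)] *(3-5) by (simp add: add_pos_pos)
  ultimately have "ln (u * g x + v * g y) < ln (g (u * x + v * y))"
    by simp
  then show "u * ln (g x) + v * ln (g y) < ln (g (u * x + v * y))"
    using ln_convex_combination_le[OF pos[OF *(1)] pos[OF *(2)], of u v] * by simp
qed

text \<open>
  The segment from \<open>x\<close> to a different point \<open>y\<close> with \<open>f x \<le> f y\<close> contains points arbitrarily close
  to \<open>x\<close>, and by strict concavity \<open>f\<close> exceeds \<open>f x\<close> at all of them. Local maximality is relative to
  a larger set \<open>S\<close>, because log-concavity is only known on the positive half of the support.
\<close>
lemma strictly_log_concave_no_lower_local_max:
  fixes f :: "real \<Rightarrow> real"
  assumes conc: "strictly_concave_on T (\<lambda>x. ln (f x))"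
    and pos: "\<And>x. x \<in> T \<Longrightarrow> 0 < f x"
    and sub: "T \<subseteq> S" and x: "x \<in> T" and y: "y \<in> T"
    and le: "f x \<le> f y"
    and max: "\<forall>\<^sub>F z in at x within S. f z \<le> f x"
  shows "x = y"
proof (rule ccontr)
  assume ne: "x \<noteq> y"
  obtain d where d: "0 < d" "\<And>z. z \<in> S \<Longrightarrow> z \<noteq> x \<Longrightarrow> dist z x < d \<Longrightarrow> f z \<le> f x"
    using max unfolding eventually_at by metis
  \<comment> \<open>Small enough for the point a fraction \<open>v\<close> along the segment to be closer than \<open>d\<close> to \<open>x\<close>.\<close>
  define v where "v = min (1/2) (d / (2 * \<bar>y - x\<bar>))"
  define z where "z = (1 - v) * x + v * y"
  have v: "0 < v" "v < 1" "v * \<bar>y - x\<bar> < d"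
  proof -
    show "0 < v" "v < 1" using d(1) ne by (auto simp: v_def)
    have "v * \<bar>y - x\<bar> \<le> d / (2 * \<bar>y - x\<bar>) * \<bar>y - x\<bar>"
      by (intro mult_right_mono) (auto simp: v_def)
    also have "\<dots> = d / 2" using ne by simp
    finally show "v * \<bar>y - x\<bar> < d" using d(1) by linarith
  qed
  have diff: "z - x = v * (y - x)" by (simp add: z_def algebra_simps)
  have zx: "z \<noteq> x" "dist z x < d"
    using diff v ne by (auto simp: dist_real_def abs_mult)
  have zT: "z \<in> T"
    using conc x y v unfolding z_def strictly_concave_on_def convex_def by auto
  have "ln (f x) \<le> (1 - v) * ln (f x) + v * ln (f y)"
  proof -
    have "v * ln (f x) \<le> v * ln (f y)"
      using v le pos[OF x] by (intro mult_left_mono) auto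
    then show ?thesis by (simp add: algebra_simps)
  qed
  also have "\<dots> < ln (f z)"
    using conc x y v ne unfolding z_def strictly_concave_on_def by auto
  finally have "f x < f z" using pos[OF x] pos[OF zT] by simp
  then show False using d(2)[of z] zx zT sub by auto
qed

lemma strictly_log_concave_local_max_unique:
  fixes f :: "real \<Rightarrow> real"
  assumes "strictly_concave_on T (\<lambda>x. ln (f x))"
    and "\<And>x. x \<in> T \<Longrightarrow> 0 < f x"
    and "T \<subseteq> S" "x \<in> T" "y \<in> T"
    and "\<forall>\<^sub>F z in at x within S. f z \<le> f x"
    and "\<forall>\<^sub>F z in at y within S. f z \<le> f y"
  shows "x = y"
proof (cases "f x \<le> f y")
  case True
  show ?thesis
    by (rule strictly_log_concave_no_lower_local_max[OF assms(1,2,3,4,5) True assms(6)])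
next
  case False
  then have "f y \<le> f x" by simp
  from strictly_log_concave_no_lower_local_max[OF assms(1,2,3,5,4) this assms(7)]
  show ?thesis by simp
qed

section \<open>Slopes at the origin\<close>

text \<open>
  Concavity is assumed on the open half-line only. The chord inequality extends to the end point
  \<open>0\<close> by letting the left end of the chord tend to \<open>0\<close>; the derivative is then bounded below by
  the slope of the chord over \<open>{0..1}\<close>.
\<close>
lemma concave_chord_slope_le_deriv:
  fixes G :: "real \<Rightarrow> real"
  assumes conc: "concave_on {0<..} G"
    and der: "(G has_real_derivative D) (at 0)"
  shows "G 1 - G 0 \<le> D"
proof -
  have lim: "(G \<longlongrightarrow> G 0) (at_right 0)"
    using DERIV_isCont[OF der] by (simp add: isCont_def filterlim_at_split)
  have chord: "G 0 + (G 1 - G 0) * x \<le> G x" if x: "0 < x" "x < 1" for x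
  proof (rule tendsto_upperbound)
    \<comment> \<open>The weight that writes \<open>x\<close> as a convex combination of \<open>s\<close> and \<open>1\<close>.\<close>
    define w where "w = (\<lambda>s. (x - s) / (1 - s))"
    have "(w \<longlongrightarrow> (x - 0) / (1 - 0)) (at_right 0)"
      unfolding w_def by (intro tendsto_intros) auto
    then show "((\<lambda>s. (1 - w s) * G s + w s * G 1) \<longlongrightarrow> G 0 + (G 1 - G 0) * x) (at_right 0)"
      by (auto intro!: tendsto_eq_intros lim simp: algebra_simps)
    have "(1 - w s) * G s + w s * G 1 \<le> G x" if s: "0 < s" "s < x" for s
    proof -
      have "0 \<le> w s" "w s \<le> 1" using s x by (auto simp: w_def field_simps)
      then have "(1 - w s) * G s + w s * G 1 \<le> G ((1 - w s) * s + w s * 1)"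
        using concave_onD[OF conc, of "w s" s 1] s by simp
      also have "(1 - w s) * s + w s * 1 = x"
      proof -
        have "w s * (1 - s) = x - s" using s x by (simp add: w_def)
        then show ?thesis by (simp add: algebra_simps)
      qed
      finally show ?thesis .
    qed
    then show "\<forall>\<^sub>F s in at_right 0. (1 - w s) * G s + w s * G 1 \<le> G x"
      using x(1) by (auto simp: eventually_at_right_field)
  qed simp
  have "((\<lambda>h. (G h - G 0) / h) \<longlongrightarrow> D) (at_right 0)"
    using der unfolding has_field_derivative_iff by (simp add: filterlim_at_split)
  moreover have "\<forall>\<^sub>F h in at_right 0. G 1 - G 0 \<le> (G h - G 0) / h"
    unfolding eventually_at_right_field
    using chord by (auto intro!: exI[of _ 1] simp: field_simps)
  ultimately show ?thesis
    by (rule tendsto_lowerbound) simp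
qed

lemma even_deriv_at_0:
  fixes f :: "real \<Rightarrow> real"
  assumes "\<And>x. f x = f (- x)" and der: "(f has_real_derivative D) (at 0)"
  shows "D = 0"
proof -
  have "((\<lambda>x. f (- x)) has_real_derivative - D) (at 0)"
    using der by (simp flip: DERIV_mirror)
  then have "(f has_real_derivative - D) (at 0)"
    by (simp flip: assms(1))
  with der have "D = - D" by (rule DERIV_unique)
  then show ?thesis by simp
qed

section \<open>Skewing a unimodal density by an increasing factor\<close>

locale increasing_skewing =
  fixes f0 G f :: "real \<Rightarrow> real"
  assumes pdf: "is_pdf f0"
    and sym: "\<And>x. f0 x = f0 (- x)"
    and G_nonneg: "\<And>x. G x \<ge> 0"
    and G_skew: "\<And>x. G x + G (- x) = 1"
    and f_eq: "\<And>x. f x = 2 * f0 x * G x"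
    and G_mono: "strict_mono G"
    and unimodal: "unimodal_at_0 f0"
begin

lemma f0_nonneg: "0 \<le> f0 x"
  using pdf by (simp add: is_pdf_def)

lemma f0_decreasing_abs: "\<bar>x\<bar> \<le> \<bar>y\<bar> \<Longrightarrow> f0 y \<le> f0 x"
proof -
  have abs: "f0 x = f0 \<bar>x\<bar>" for x using sym[of x] by (auto simp: abs_if)
  assume "\<bar>x\<bar> \<le> \<bar>y\<bar>"
  then have "f0 \<bar>y\<bar> \<le> f0 \<bar>x\<bar>"
    using unimodal by (auto simp: unimodal_at_0_def monotone_on_def)
  then show ?thesis using abs[of x] abs[of y] by simp
qed

lemma G_pos: "0 < G x"
  using G_nonneg[of "x - 1"] strict_monoD[OF G_mono, of "x - 1" x] by simp

lemma G_less_1: "G x < 1"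
  using G_skew[of x] G_pos[of "- x"] by linarith

lemma G_0: "G 0 = 1/2"
  using G_skew[of 0] by simp

lemma f_0: "f 0 = f0 0"
  by (simp add: f_eq G_0)

lemma f_le: "f x \<le> 2 * f0 x"
  using f0_nonneg[of x] G_less_1[of x] mult_left_mono[of "G x" 1 "2 * f0 x"]
  by (simp add: f_eq)

lemma f_pos_iff: "0 < f x \<longleftrightarrow> 0 < f0 x"
  using G_pos[of x] by (simp add: f_eq zero_less_mult_iff)

text \<open>
  A density cannot vanish off a null set, so it is positive at some point other than \<open>0\<close>, hence by
  symmetry and unimodality at every point that is no further from \<open>0\<close>.
\<close>
lemma density_positive_near_0: obtains p where "0 < p" "\<And>x. \<bar>x\<bar> \<le> p \<Longrightarrow> 0 < f0 x"
proof -
  have "\<exists>p. p \<noteq> 0 \<and> f0 p \<noteq> 0"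
  proof (rule ccontr)
    assume "\<not> ?thesis"
    then have zero: "f0 x = 0" if "x \<noteq> 0" for x using that by blast
    have "AE x in lborel. f0 x = 0"
      using AE_lborel_singleton[of "0::real"] by eventually_elim (rule zero)
    then have "(\<integral>x. f0 x \<partial>lborel) = 0" by (rule integral_eq_zero_AE)
    then show False using pdf by (simp add: is_pdf_def has_bochner_integral_iff)
  qed
  then obtain p where p: "p \<noteq> 0" "0 < f0 p" using f0_nonneg by (metis order_less_le)
  show thesis
  proof (rule that)
    show "0 < \<bar>p\<bar>" using p by simp
    show "0 < f0 x" if "\<bar>x\<bar> \<le> \<bar>p\<bar>" for x
      using f0_decreasing_abs[OF that] p(2) by linarith
  qed
qed

lemma f0_0_pos: "0 < f0 0"
  using density_positive_near_0 by (metis abs_zero less_imp_le)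

lemma positive_subset_support: "{x. 0 < f0 x} \<subseteq> pdf_support f0"
  by (simp add: pdf_support_def closure_subset)

lemma zero_interior_support: "0 \<in> interior (pdf_support f0)"
proof -
  obtain p where p: "0 < p" "\<And>x. \<bar>x\<bar> \<le> p \<Longrightarrow> 0 < f0 x"
    using density_positive_near_0 by blast
  have "ball 0 p \<subseteq> pdf_support f0"
    using p(2) positive_subset_support by (auto simp: dist_real_def)
  then show ?thesis using p(1) by (meson centre_in_ball interior_maximal open_ball subsetD)
qed

text \<open>
  At an end point of the support the density may be \<open>0\<close>, but it is positive at all points nearer to
  the centre.
\<close>
lemma f0_pos_below_support:
  assumes "x \<in> pdf_support f0" "\<bar>y\<bar> < \<bar>x\<bar>"
  shows "0 < f0 y"
proof -
  have "0 < \<bar>x\<bar> - \<bar>y\<bar>" using assms by simp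
  then obtain p where p: "0 < f0 p" "dist p x < \<bar>x\<bar> - \<bar>y\<bar>"
    using assms(1) unfolding pdf_support_def closure_approachable by blast
  then have "\<bar>y\<bar> \<le> \<bar>p\<bar>" by (simp add: dist_real_def)
  from f0_decreasing_abs[OF this] p(1) show ?thesis by linarith
qed

lemma f_bounded: "f x \<le> 2 * f0 0"
  using f_le[of x] f0_decreasing_abs[of 0 x] by simp

lemma mode_is_local_max:
  "is_mode_on (pdf_support f0) f x \<longleftrightarrow>
    x \<in> pdf_support f0 \<and> (\<forall>\<^sub>F y in at x within pdf_support f0. f y \<le> f x)"
proof -
  have False
    if "x islimpt pdf_support f0" "filterlim f at_top (at x within pdf_support f0)"
  proof -
    have "\<forall>\<^sub>F y in at x within pdf_support f0. 2 * f0 0 < f y"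
      using that(2) by (simp add: filterlim_at_top_dense)
    then have "\<forall>\<^sub>F y in at x within pdf_support f0. False"
      by eventually_elim (use f_bounded in \<open>simp add: not_less[symmetric]\<close>)
    then show False using that(1) by (simp add: trivial_limit_within)
  qed
  then show ?thesis by (auto simp: is_mode_on_def)
qed

text \<open>
  Just to the right of a negative point of the support \<open>f0\<close> is positive and no smaller, while \<open>G\<close> is
  strictly larger.
\<close>
lemma no_negative_mode:
  assumes "x < 0"
  shows "\<not> is_mode_on (pdf_support f0) f x"
proof
  assume "is_mode_on (pdf_support f0) f x"
  then have S: "x \<in> pdf_support f0" and "\<forall>\<^sub>F y in at x within pdf_support f0. f y \<le> f x"
    by (simp_all add: mode_is_local_max)
  then obtain d where d: "0 < d"
    "\<And>y. y \<in> pdf_support f0 \<Longrightarrow> y \<noteq> x \<Longrightarrow> dist y x < d \<Longrightarrow> f y \<le> f x"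
    unfolding eventually_at by metis
  define y where "y = x + min (d / 2) (- x / 2)"
  have y: "x < y" "y < 0" "dist y x < d"
    using d(1) assms by (auto simp: y_def dist_real_def min_def)
  have pos: "0 < f0 y" using f0_pos_below_support[OF S, of y] y by simp
  have "f x \<le> 2 * f0 y * G x"
    using f0_decreasing_abs[of y x] y G_nonneg[of x] by (simp add: f_eq mult_right_mono)
  also have "\<dots> < f y"
    using pos strict_monoD[OF G_mono y(1)] by (simp add: f_eq)
  finally show False
    using d(2)[of y] y pos positive_subset_support by auto
qed

text \<open>
  On \<open>{0..x}\<close> the density is at least \<open>f0 x\<close>, so the rectangle of that height has area at most \<open>1\<close>.
\<close>
lemma f0_tail: "0 < x \<Longrightarrow> x * f0 x \<le> 1"
proof -
  assume x: "0 < x"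
  have "x * f0 x = (\<integral>t. indicator {0..x} t * f0 x \<partial>lborel)"
    using x by simp
  also have "\<dots> \<le> (\<integral>t. f0 t \<partial>lborel)"
  proof (rule integral_mono)
    show "integrable lborel (\<lambda>t. indicator {0..x} t * f0 x)"
      using x by (intro integrable_mult_left integrable_real_indicator) auto
    show "integrable lborel f0" using pdf by (simp add: is_pdf_def has_bochner_integral_iff)
    show "indicator {0..x} t * f0 x \<le> f0 t" for t
      using f0_decreasing_abs[of t x] f0_nonneg[of t] by (auto simp: indicator_def)
  qed
  also have "\<dots> = 1" using pdf by (simp add: is_pdf_def has_bochner_integral_iff)
  finally show ?thesis .
qed

text \<open>
  Since \<open>f0\<close> is even, its derivative at \<open>0\<close> vanishes, and the product rule leaves only the term with
  the derivative of \<open>G\<close>. Differentiability of \<open>f0\<close> is essential here: a density with a cusp at \<open>0\<close>,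
  such as the Laplace density, can make \<open>f\<close> decrease at once.
\<close>
lemma increases_right_of_0:
  assumes df0: "(f0 has_real_derivative D0) (at 0)"
    and dG: "(G has_real_derivative D1) (at 0)"
    and conc: "concave_on {0<..} G"
  obtains d where "0 < d" "\<And>h. 0 < h \<Longrightarrow> h < d \<Longrightarrow> f 0 < f h"
proof -
  have D0: "D0 = 0" using even_deriv_at_0[of f0, OF sym df0] .
  have "0 < G 1 - G 0" using strict_monoD[OF G_mono, of 0 1] by simp
  also have "\<dots> \<le> D1" by (rule concave_chord_slope_le_deriv[OF conc dG])
  finally have D1: "0 < D1" .
  have "((\<lambda>x. 2 * f0 x * G x) has_real_derivative 2 * f0 0 * D1) (at 0)"
    using D0 by (auto intro!: derivative_eq_intros df0 dG)
  then have "(f has_real_derivative 2 * f0 0 * D1) (at 0)"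
    by (simp flip: f_eq)
  from has_real_derivative_pos_inc_right[OF this] D1 f0_0_pos show thesis
    by (auto intro: that)
qed

text \<open>
  Cutting the support off at a point beyond which \<open>f \<le> f 0\<close> makes it compact whether or not it was
  bounded. The maximum over the compact piece exceeds \<open>f 0\<close>, so it is not attained at \<open>0\<close>.
\<close>
lemma positive_mode_exists:
  assumes cont: "continuous_on (pdf_support f0) f"
    and d: "0 < d" "\<And>h. 0 < h \<Longrightarrow> h < d \<Longrightarrow> f 0 < f h"
  shows "\<exists>x>0. is_mode_on (pdf_support f0) f x"
proof -
  let ?S = "pdf_support f0"
  obtain p where p: "0 < p" "\<And>x. \<bar>x\<bar> \<le> p \<Longrightarrow> 0 < f0 x"
    using density_positive_near_0 by blast
  define h where "h = min p (d / 2)"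
  have h: "0 < h" "h < d" "h \<in> ?S"
    using p d(1) positive_subset_support by (auto simp: h_def)
  have fh: "f 0 < f h" using d(2) h by simp
  \<comment> \<open>From \<open>2 / f0 0\<close> onwards the tail bound gives \<open>f x \<le> 2 * f0 x \<le> 2 / x \<le> f0 0 = f 0\<close>; and \<open>h\<close>
     has to lie in the compact piece.\<close>
  define X where "X = max h (2 / f0 0)"
  have tail: "f x \<le> f 0" if "X \<le> x" for x
  proof -
    have x: "0 < x" "2 / f0 0 \<le> x" using that h by (auto simp: X_def)
    have "2 * f0 x \<le> f0 0 * x * f0 x"
      using x f0_0_pos f0_nonneg[of x] by (intro mult_right_mono) (auto simp: field_simps)
    also have "\<dots> \<le> f0 0"
      using mult_left_mono[OF f0_tail[OF x(1)], of "f0 0"] f0_0_pos by (simp add: mult.assoc)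
    finally show ?thesis using f_le[of x] by (simp add: f_0)
  qed
  have "compact (?S \<inter> {0..X})"
    by (intro closed_Int_compact) (auto simp: pdf_support_def)
  moreover have hK: "h \<in> ?S \<inter> {0..X}" using h by (auto simp: X_def)
  moreover have "continuous_on (?S \<inter> {0..X}) f"
    using cont by (rule continuous_on_subset) simp
  ultimately obtain m where m: "m \<in> ?S \<inter> {0..X}" "\<And>y. y \<in> ?S \<inter> {0..X} \<Longrightarrow> f y \<le> f m"
    using continuous_attains_sup[of "?S \<inter> {0..X}" f] by blast
  have fm: "f 0 < f m" using fh m(2)[OF hK] by simp
  then have m0: "0 < m" using m(1) by (cases "m = 0") auto
  have "f y \<le> f m" if "y \<in> ?S" "0 < y" for y
    using m(2)[of y] tail[of y] fm that by (cases "y \<le> X") auto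
  then have "\<forall>\<^sub>F y in at m within ?S. f y \<le> f m"
    unfolding eventually_at using m0
    by (intro exI[of _ m]) (auto simp: dist_real_def abs_if split: if_splits)
  then show ?thesis using m m0 by (auto simp: mode_is_local_max)
qed

text \<open>
  An end point of the support at which \<open>f0\<close> vanishes is a limit of points with \<open>f > 0\<close>, hence no
  mode. So every mode lies in the set on which \<open>f\<close> is log-concave.
\<close>
lemma mode_has_positive_density:
  assumes mode: "is_mode_on (pdf_support f0) f x"
  shows "0 < f0 x"
proof (rule ccontr)
  assume "\<not> 0 < f0 x"
  then have zero: "f0 x = 0" using f0_nonneg[of x] by simp
  from mode have S: "x \<in> pdf_support f0" and "\<forall>\<^sub>F y in at x within pdf_support f0. f y \<le> f x"
    by (simp_all add: mode_is_local_max)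
  then obtain d where d: "0 < d"
    "\<And>y. y \<in> pdf_support f0 \<Longrightarrow> y \<noteq> x \<Longrightarrow> dist y x < d \<Longrightarrow> f y \<le> f x"
    unfolding eventually_at by metis
  obtain y where y: "0 < f0 y" "dist y x < d"
    using S d(1) unfolding pdf_support_def closure_approachable by blast
  have "y \<in> pdf_support f0" using y(1) positive_subset_support by blast
  moreover have "y \<noteq> x" using y(1) zero by auto
  ultimately have "f y \<le> f x" using y(2) by (rule d(2))
  also have "f x = 0" by (simp add: f_eq zero)
  finally show False using y(1) f_pos_iff[of y] by simp
qed

lemma strictly_log_concave_right_of_0:
  assumes conc: "concave_on {0<..} G" and lc: "log_concave_pdf f0"
    and strict: "strictly_concave_on {0<..} G \<or> strictly_log_concave_pdf f0"
  shows "strictly_concave_on ({x. 0 < f0 x} \<inter> {0<..}) (\<lambda>x. ln (f x))"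
proof -
  let ?T = "{x. 0 < f0 x} \<inter> {0<..}"
  have conv: "convex ?T"
    using lc convex_real_interval(2)[of 0] unfolding log_concave_pdf_def
    by (intro convex_Int) (auto dest: concave_on_imp_convex)
  have lnf0: "concave_on ?T (\<lambda>x. ln (f0 x))"
    using lc conv unfolding log_concave_pdf_def by (auto intro: concave_on_subset_convex)
  have lnG: "concave_on ?T (\<lambda>x. ln (G x))"
    using conc conv by (intro concave_on_ln_compose G_pos) (auto intro: concave_on_subset_convex)
  have "strictly_concave_on ?T (\<lambda>x. ln (f0 x) + ln (G x))"
    using strict
  proof
    assume "strictly_concave_on {0<..} G"
    then have "strictly_concave_on ?T (\<lambda>x. ln (G x))"
      using conv by (intro strictly_concave_on_ln_compose G_pos)
        (auto intro: strictly_concave_on_subset)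
    from strictly_concave_on_add_concave[OF this lnf0]
    show ?thesis by (simp add: add.commute)
  next
    assume "strictly_log_concave_pdf f0"
    then have "strictly_concave_on ?T (\<lambda>x. ln (f0 x))"
      using conv unfolding strictly_log_concave_pdf_def
      by (auto intro: strictly_concave_on_subset)
    from strictly_concave_on_add_concave[OF this lnG] show ?thesis .
  qed
  then have *: "strictly_concave_on ?T (\<lambda>x. (ln (f0 x) + ln (G x)) + ln 2)"
    by (rule strictly_concave_on_add_concave) (simp add: concave_on_const conv)
  have "ln (f x) = (ln (f0 x) + ln (G x)) + ln 2" if "x \<in> ?T" for x
    using that G_pos[of x] by (simp add: f_eq ln_mult)
  with * conv show ?thesis
    unfolding strictly_concave_on_def convex_def by auto
qed

lemma unique_positive_mode:
  assumes cd: "continuously_differentiable_within (pdf_support f0) f0"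
    "continuously_differentiable_within (pdf_support f0) G"
    and conc: "concave_on {0<..} G" and lc: "log_concave_pdf f0"
    and strict: "strictly_concave_on {0<..} G \<or> strictly_log_concave_pdf f0"
  shows "\<exists>!x. x > 0 \<and> is_mode_on (pdf_support f0) f x"
proof -
  let ?S = "pdf_support f0" and ?T = "{x. 0 < f0 x} \<inter> {0<..}"
  obtain f0' G' where
    f0': "\<And>x. x \<in> ?S \<Longrightarrow> (f0 has_real_derivative f0' x) (at x within ?S)" and
    G': "\<And>x. x \<in> ?S \<Longrightarrow> (G has_real_derivative G' x) (at x within ?S)"
    using cd unfolding continuously_differentiable_within_def by blast
  have "continuous_on ?S f0" "continuous_on ?S G"
    using f0' G' by (auto intro: DERIV_continuous_on)
  then have "continuous_on ?S f"
    unfolding f_eq[abs_def] by (intro continuous_intros)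
  moreover have "0 \<in> ?S" using zero_interior_support interior_subset by blast
  then have "(f0 has_real_derivative f0' 0) (at 0)" "(G has_real_derivative G' 0) (at 0)"
    using f0'[of 0] G'[of 0] at_within_interior[OF zero_interior_support] by simp_all
  then obtain d where "0 < d" "\<And>h. 0 < h \<Longrightarrow> h < d \<Longrightarrow> f 0 < f h"
    using increases_right_of_0[OF _ _ conc] by blast
  ultimately have ex: "\<exists>x>0. is_mode_on ?S f x" by (rule positive_mode_exists)
  have "x = y"
    if "0 < x" "is_mode_on ?S f x" "0 < y" "is_mode_on ?S f y" for x y
  proof (rule strictly_log_concave_local_max_unique)
    show "strictly_concave_on ?T (\<lambda>x. ln (f x))"
      by (rule strictly_log_concave_right_of_0[OF conc lc strict])
    show "0 < f z" if "z \<in> ?T" for z using that by (simp add: f_pos_iff)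
    show "?T \<subseteq> ?S" using positive_subset_support by blast
    show "x \<in> ?T" "y \<in> ?T" using that by (auto intro: mode_has_positive_density)
    show "\<forall>\<^sub>F z in at x within ?S. f z \<le> f x" "\<forall>\<^sub>F z in at y within ?S. f z \<le> f y"
      using that by (simp_all add: mode_is_local_max)
  qed
  with ex show ?thesis by blast
qed

end

section \<open>Reflection at the origin\<close>

lemma at_within_reflect:
  fixes x :: real
  assumes S: "\<And>y. y \<in> S \<longleftrightarrow> - y \<in> S"
  shows "at (- x) within S = filtermap uminus (at x within S)"
proof (rule filter_eqI)
  fix P
  show "eventually P (at (- x) within S) = eventually P (filtermap uminus (at x within S))"
    unfolding eventually_filtermap eventually_at
    by (intro ex_cong1 conj_cong refl)
      (smt (verit, best) S dist_minus minus_minus)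
qed

lemma is_mode_on_reflect:
  assumes S: "\<And>y. y \<in> S \<longleftrightarrow> - y \<in> S"
  shows "is_mode_on S (\<lambda>x. f (- x)) x \<longleftrightarrow> is_mode_on S f (- x)"
proof -
  have "(- x) islimpt S \<longleftrightarrow> x islimpt S"
    using trivial_limit_within[of x S] trivial_limit_within[of "- x" S]
    by (simp add: at_within_reflect[OF S] filtermap_bot_iff)
  then show ?thesis
    using S[of x] at_within_reflect[OF S, of x]
    by (simp add: is_mode_on_def eventually_filtermap filterlim_filtermap)
qed

lemma pdf_support_reflect:
  assumes "\<And>x. f0 x = f0 (- x)"
  shows "y \<in> pdf_support f0 \<longleftrightarrow> - y \<in> pdf_support f0"
proof -
  have "- y \<in> pdf_support f0" if "y \<in> pdf_support f0" for y
    using that unfolding pdf_support_def closure_approachable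
    by (metis assms dist_minus mem_Collect_eq)
  from this[of y] this[of "- y"] show ?thesis by auto
qed

lemma concave_on_reflect:
  fixes G :: "real \<Rightarrow> real"
  assumes "concave_on {..<0} G"
  shows "concave_on {0<..} (\<lambda>x. G (- x))"
  unfolding concave_on_iff
proof (intro conjI ballI allI impI)
  fix x y u v :: real
  assume "x \<in> {0<..}" "y \<in> {0<..}" "0 \<le> u" "0 \<le> v" "u + v = 1"
  then have "u * G (- x) + v * G (- y) \<le> G (u * (- x) + v * (- y))"
    using assms unfolding concave_on_iff
    by (metis greaterThan_iff lessThan_iff neg_less_0_iff_less real_scaleR_def)
  then show "u * G (- x) + v * G (- y) \<le> G (- (u *\<^sub>R x + v *\<^sub>R y))" by simp
qed simp

lemma strictly_concave_on_reflect:
  fixes G :: "real \<Rightarrow> real"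
  assumes "strictly_concave_on {..<0} G"
  shows "strictly_concave_on {0<..} (\<lambda>x. G (- x))"
  unfolding strictly_concave_on_def
proof (intro conjI ballI allI impI)
  fix x y u v :: real
  assume "x \<in> {0<..}" "y \<in> {0<..}" "0 < u" "0 < v" "x \<noteq> y \<and> u + v = 1"
  then have "u * G (- x) + v * G (- y) < G (u * (- x) + v * (- y))"
    using assms unfolding strictly_concave_on_def
    by (metis greaterThan_iff lessThan_iff neg_less_0_iff_less neg_equal_iff_equal)
  then show "u * G (- x) + v * G (- y) < G (- (u * x + v * y))" by simp
qed simp

theorem proposition9:
  fixes f0 G f :: "real \<Rightarrow> real"
  assumes pdf: "is_pdf f0"
    and sym: "\<And>x. f0 x = f0 (- x)"
    and G_nonneg: "\<And>x. G x \<ge> 0"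
    and G_skew: "\<And>x. G x + G (- x) = 1"
    and f_eq: "\<And>x. f x = 2 * f0 x * G x"
  shows
    "(strict_mono G \<and> unimodal_at_0 f0 \<longrightarrow>
        \<not> (\<exists>x<0. is_mode_on (pdf_support f0) f x) \<and>
        (continuously_differentiable_within (pdf_support f0) f0 \<and>
         continuously_differentiable_within (pdf_support f0) G \<and>
         concave_on {0<..} G \<and> log_concave_pdf f0 \<and>
         (strictly_concave_on {0<..} G \<or> strictly_log_concave_pdf f0) \<longrightarrow>
           (\<exists>!x. x > 0 \<and> is_mode_on (pdf_support f0) f x)))
     \<and>
     (strict_antimono_on UNIV G \<and> unimodal_at_0 f0 \<longrightarrow>
        \<not> (\<exists>x>0. is_mode_on (pdf_support f0) f x) \<and>
        (continuously_differentiable_within (pdf_support f0) f0 \<and>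
         continuously_differentiable_within (pdf_support f0) G \<and>
         concave_on {..<0} G \<and> log_concave_pdf f0 \<and>
         (strictly_concave_on {..<0} G \<or> strictly_log_concave_pdf f0) \<longrightarrow>
           (\<exists>!x. x < 0 \<and> is_mode_on (pdf_support f0) f x)))"
    (is "(?inc \<longrightarrow> ?noneg \<and> (?smooth1 \<longrightarrow> ?unique1)) \<and>
      (?dec \<longrightarrow> ?nopos \<and> (?smooth2 \<longrightarrow> ?unique2))")
proof (rule conjI; rule impI)
  assume ?inc
  then interpret increasing_skewing f0 G f
    using assms by unfold_locales auto
  show "?noneg \<and> (?smooth1 \<longrightarrow> ?unique1)"
    using no_negative_mode unique_positive_mode by blast
next
  assume dec: ?dec
  let ?S = "pdf_support f0" and ?Gr = "\<lambda>x. G (- x)" and ?fr = "\<lambda>x. f (- x)"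
  interpret r: increasing_skewing f0 ?Gr ?fr
  proof
    show "?Gr x + ?Gr (- x) = 1" for x using G_skew[of "- x"] by simp
    show "?fr x = 2 * f0 x * ?Gr x" for x using f_eq[of "- x"] sym[of x] by simp
    show "strict_mono ?Gr" using dec by (auto simp: strict_mono_def monotone_on_def)
  qed (use assms dec in auto)
  have mode: "is_mode_on ?S ?fr x \<longleftrightarrow> is_mode_on ?S f (- x)" for x
    by (rule is_mode_on_reflect) (rule pdf_support_reflect[of f0, OF sym])
  have ?nopos
    using r.no_negative_mode[of "- x" for x] by (auto simp: mode)
  moreover have ?unique2 if smooth: ?smooth2
  proof -
    \<comment> \<open>By skew-symmetry the reflected factor is \<open>1 - G\<close>, differentiable wherever \<open>G\<close> is.\<close>
    have Gr_eq: "?Gr = (\<lambda>x. 1 - G x)"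
      using G_skew by (auto simp: fun_eq_iff algebra_simps)
    obtain G' where "continuous_on ?S G'"
      "\<And>x. x \<in> ?S \<Longrightarrow> (G has_real_derivative G' x) (at x within ?S)"
      using smooth unfolding continuously_differentiable_within_def by blast
    then have "continuous_on ?S (\<lambda>x. - G' x)"
      "\<And>x. x \<in> ?S \<Longrightarrow> ((\<lambda>x. 1 - G x) has_real_derivative - G' x) (at x within ?S)"
      by (auto intro!: continuous_intros derivative_eq_intros)
    then have "continuously_differentiable_within ?S ?Gr"
      unfolding Gr_eq continuously_differentiable_within_def by blast
    then have "\<exists>!x. x > 0 \<and> is_mode_on ?S ?fr x"
      using smooth by (intro r.unique_positive_mode)
        (auto intro: concave_on_reflect strictly_concave_on_reflect)
    then have ex: "\<exists>!x. x > 0 \<and> is_mode_on ?S f (- x)" by (simp add: mode)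
    then obtain x where x: "x > 0" "is_mode_on ?S f (- x)" by blast
    show ?unique2
    proof (rule ex1I[of _ "- x"])
      fix y assume "y < 0 \<and> is_mode_on ?S f y"
      then have "- y > 0 \<and> is_mode_on ?S f (- (- y))" by simp
      with ex x have "- y = x" by blast
      then show "y = - x" by simp
    qed (use x in simp)
  qed
  ultimately show "?nopos \<and> (?smooth2 \<longrightarrow> ?unique2)" by blast
qed

end
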